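(* Let $X$, $Z$ be non-trivial real locally convex topological linear spaces, $C\subseteq Z$ a convex cone with $0\in C$, and $T \colon Z \to X$ an injective continuous linear operator with adjoint $T^*\colon X^*\to Z^*$. Let $f \colon X \to \mathcal G(Z, C)$ be convex and $T$-translative, let $z^* \in C^+\setminus\{0\}$ and $\bar x\in X$. If $\partial f_{z^*}(\bar x) \neq \emptyset$ then $$\partial f_{z^*}(\bar x) = \{x^* \in X^* \mid z^* = T^*x^* \text{ and } \forall x \in A_f \colon S_{(x^*, T^*x^* )}(x) \supseteq S_{(x^*, T^*x^* )}(\bar x) \ominus f(\bar x)\}.$$
   Context: $C^+ = \{z^* \in Z^* \mid \forall z \in C\colon z^*(z)\ge 0\}$. $\mathcal G(Z,C) = \{A \subseteq Z \mid A = \operatorname{cl}\operatorname{co}(A+C)\}$ (containing $\emptyset$ and $Z$); $A + \emptyset=\emptyset$; $A\oplus B = \operatorname{cl}(A+B)$; inf-residuation: $A \ominus B = \{z\in Z\mid B+z\subseteq A\}$ (so $A\ominus\emptyset = Z$). $f$ is convex if $\operatorname{graph} f=\{(x,z)\mid z\in f(x)\}$ is convex. $f$ is $T$-translative if $f(x+Tz) = f(x)+\{z\}$ for all $x\in X$, $z\in Z$. $A_f = \{x\in X\mid 0\in f(x)\}$. $S_{(x^*,z^* )}(x) = \{z\in Z\mid x^*(x)\le z^*(z)\}$; $H^+(z^* ) = \{z\in Z\mid z^*(z)\ge0\}$. Directional derivative: $f'_{z^*}(\bar x,x) = \bigcap_{s>0}\operatorname{cl}\bigcup_{0<t<s}\frac1t\big[(f(\bar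 x+tx)\oplus H^+(z^* ))\ominus f(\bar x)\big]$. The $z^*$-subdifferential is $\partial f_{z^*}(\bar x) = \{x^*\in X^*\mid\forall x\in X\colon S_{(x^*,z^* )}(x)\supseteq f'_{z^*}(\bar x,x)\}$. *)

theory Defs
  imports "HOL-Analysis.Analysis"
begin

class real_tvs = real_vector + topological_ab_group_add +
  assumes tendsto_scaleR_Pair:
    "((\<lambda>p. fst p *\<^sub>R snd p) \<longlongrightarrow> c *\<^sub>R a) (nhds (c::real) \<times>\<^sub>F nhds a)"

(* No separation axiom is part of the class. The second conjunct is convex V written out, since
   a class specification cannot mention a constant that needs the sort real_vector. *)
class real_lctvs = real_tvs +
  assumes open_convex_base_0_raw:
    "open U \<Longrightarrow> 0 \<in> U \<Longrightarrow>
       \<exists>V. open V \<and>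
         (\<forall>x\<in>V. \<forall>y\<in>V. \<forall>u\<ge>0. \<forall>v\<ge>0. u + v = 1 \<longrightarrow> u *\<^sub>R x + v *\<^sub>R y \<in> V) \<and>
         0 \<in> V \<and> V \<subseteq> U"

lemma open_convex_base_0:
  fixes U :: "'a::real_lctvs set"
  assumes "open U" "0 \<in> U"
  shows "\<exists>V. open V \<and> convex V \<and> 0 \<in> V \<and> V \<subseteq> U"
  using open_convex_base_0_raw[OF assms] by (simp add: convex_def)

instance real_normed_vector \<subseteq> real_lctvs
proof
  fix c :: real and a :: 'a
  show "((\<lambda>p. fst p *\<^sub>R snd p) \<longlongrightarrow> c *\<^sub>R a) (nhds c \<times>\<^sub>F nhds a)"
    by (intro tendsto_scaleR filterlim_fst filterlim_snd)
next
  fix U :: "'a set"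
  assume "open U" "0 \<in> U"
  then obtain e where "e > 0" "ball 0 e \<subseteq> U"
    using open_contains_ball by blast
  then show "\<exists>V. open V \<and>
      (\<forall>x\<in>V. \<forall>y\<in>V. \<forall>u\<ge>0. \<forall>v\<ge>0. u + v = 1 \<longrightarrow> u *\<^sub>R x + v *\<^sub>R y \<in> V) \<and>
      0 \<in> V \<and> V \<subseteq> U"
    using convex_ball[of "0::'a" e]
    by (intro exI[of _ "ball 0 e"]) (simp add: convex_def)
qed

definition topological_dual :: "('a::real_tvs \<Rightarrow> real) set" where
  "topological_dual = {x'. linear x' \<and> continuous_on UNIV x'}"

definition dual_adjoint :: "('z \<Rightarrow> 'x) \<Rightarrow> ('x \<Rightarrow> real) \<Rightarrow> 'z \<Rightarrow> real" where
  "dual_adjoint T x' = x' \<circ> T"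

definition dual_cone :: "'z::real_tvs set \<Rightarrow> ('z \<Rightarrow> real) set" where
  "dual_cone C = {z' \<in> topological_dual. \<forall>z\<in>C. z' z \<ge> 0}"

(* Sums of sets are the Minkowski sums of Set_Algebras; in particular A + {} = {}. *)
definition upper_sets :: "'z::real_tvs set \<Rightarrow> 'z set set" where
  "upper_sets C = {A. A = closure (convex hull (A + C))}"

definition closed_sum :: "'z::real_tvs set \<Rightarrow> 'z set \<Rightarrow> 'z set" (infixl \<open>\<oplus>\<^sub>c\<close> 65) where
  "A \<oplus>\<^sub>c B = closure (A + B)"

definition inf_residual :: "'z::real_vector set \<Rightarrow> 'z set \<Rightarrow> 'z set" (infixl \<open>\<ominus>\<^sub>r\<close> 65) where
  "A \<ominus>\<^sub>r B = {z. B + {z} \<subseteq> A}"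

definition set_graph :: "('x \<Rightarrow> 'z set) \<Rightarrow> ('x \<times> 'z) set" where
  "set_graph f = {(x, z). z \<in> f x}"

definition convex_setfun :: "('x::real_vector \<Rightarrow> 'z::real_vector set) \<Rightarrow> bool" where
  "convex_setfun f \<longleftrightarrow> convex (set_graph f)"

definition translative :: "('z \<Rightarrow> 'x) \<Rightarrow> ('x::real_vector \<Rightarrow> 'z::real_vector set) \<Rightarrow> bool" where
  "translative T f \<longleftrightarrow> (\<forall>x z. f (x + T z) = f x + {z})"

definition zero_level_set :: "('x \<Rightarrow> 'z::zero set) \<Rightarrow> 'x set" where
  "zero_level_set f = {x. 0 \<in> f x}"

definition S_fun :: "('x \<Rightarrow> real) \<Rightarrow> ('z \<Rightarrow> real) \<Rightarrow> 'x \<Rightarrow> 'z set" where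
  "S_fun x' z' x = {z. x' x \<le> z' z}"

definition Hplus :: "('z \<Rightarrow> real) \<Rightarrow> 'z set" where
  "Hplus z' = {z. z' z \<ge> 0}"

definition dir_deriv ::
  "('x::real_vector \<Rightarrow> 'z::real_tvs set) \<Rightarrow> ('z \<Rightarrow> real) \<Rightarrow> 'x \<Rightarrow> 'x \<Rightarrow> 'z set" where
  "dir_deriv f z' xb x =
     (\<Inter>s\<in>{0::real<..}. closure (\<Union>t\<in>{0<..<s}.
        (\<lambda>z. (1 / t) *\<^sub>R z) ` ((f (xb + t *\<^sub>R x) \<oplus>\<^sub>c Hplus z') \<ominus>\<^sub>r f xb)))"

definition subdifferential ::
  "('x::real_tvs \<Rightarrow> 'z::real_tvs set) \<Rightarrow> ('z \<Rightarrow> real) \<Rightarrow> 'x \<Rightarrow> ('x \<Rightarrow> real) set" where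
  "subdifferential f z' xb =
     {x' \<in> topological_dual. \<forall>x. S_fun x' z' x \<supseteq> dir_deriv f z' xb x}"

end

theory Submission
  imports Defs
begin

text \<open>
  Scalarization turns every set in the statement into a half-space of \<open>z'\<close>. If the
  subdifferential is non-empty, then \<open>m = inf z'[f xb]\<close> is finite, since otherwise the
  directional derivative in direction \<open>0\<close> would be the whole space. By convexity,
  \<open>x'\<close> is a subgradient iff \<open>x' (x - xb) + m \<le> z' z\<close> for all \<open>x\<close> and
  \<open>z \<in> f x\<close>. Translativity makes this inequality at \<open>x = xb + T z\<close> force
  \<open>x' \<circ> T = z'\<close>, and lets every pair \<open>z \<in> f x\<close> be moved to
  \<open>0 \<in> f (x - T z)\<close>, so that the inequality only has to be tested on the zero level set.
\<close>

text \<open>Residuation by a set yields one bound for each of its points. All these bounds share the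
  shift \<open>d\<close>, so only the infimum of the values matters.\<close>

lemma cINF_le_iff_add_le:
  fixes g :: "'a \<Rightarrow> real"
  assumes "A \<noteq> {}" and "bdd_below (g ` A)"
  shows "(\<forall>a\<in>A. c \<le> g a + d) \<longleftrightarrow> c \<le> Inf (g ` A) + d"
  using le_cINF_iff[OF assms, of "c - d"] by (simp add: diff_le_eq)

lemma linear_surj_real:
  fixes g :: "'a::real_vector \<Rightarrow> real"
  assumes "linear g" and "g \<noteq> (\<lambda>z. 0)"
  obtains w where "g w = c"
proof -
  obtain u where "g u \<noteq> 0" using assms(2) by auto
  then have "g ((c / g u) *\<^sub>R u) = c" by (simp add: linear_scale[OF assms(1)])
  then show ?thesis using that by blast
qed

lemma linear_le_imp_eq:
  fixes g h :: "'a::real_vector \<Rightarrow> real"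
  assumes "linear g" and "linear h" and "\<And>z. g z \<le> h z"
  shows "g = h"
proof
  fix z
  show "g z = h z"
    using assms(3)[of z] assms(3)[of "- z"] by (simp add: linear_neg[OF assms(1)] linear_neg[OF assms(2)])
qed

text \<open>Adding the half-space erases everything about \<open>A\<close> except which values
  \<open>z'\<close> takes on it, since \<open>z = a + (z - a)\<close>.\<close>

lemma add_Hplus:
  fixes z' :: "'z::real_vector \<Rightarrow> real"
  assumes "linear z'"
  shows "A + Hplus z' = {z. \<exists>a\<in>A. z' a \<le> z' z}"
proof (intro equalityI subsetI)
  fix z assume "z \<in> A + Hplus z'"
  then show "z \<in> {z. \<exists>a\<in>A. z' a \<le> z' z}"
    by (force elim!: set_plus_elim simp: Hplus_def linear_add[OF assms])
next
  fix z assume "z \<in> {z. \<exists>a\<in>A. z' a \<le> z' z}"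
  then obtain a where a: "a \<in> A" "z' a \<le> z' z" by blast
  then have "a + (z - a) \<in> A + Hplus z'"
    by (intro set_plus_intro) (simp_all add: Hplus_def linear_diff[OF assms])
  then show "z \<in> A + Hplus z'" by simp
qed

lemma mem_inf_residual: "z \<in> A \<ominus>\<^sub>r B \<longleftrightarrow> (\<forall>b\<in>B. b + z \<in> A)"
  by (auto simp: inf_residual_def set_plus_def)

lemma closed_halfspace_dual:
  fixes z' :: "'z::real_tvs \<Rightarrow> real"
  assumes "z' \<in> topological_dual"
  shows "closed {z. c \<le> z' z}"
  using assms by (intro closed_Collect_le) (auto simp: topological_dual_def)

text \<open>It is enough that \<open>w\<close> itself is a difference quotient for arbitrarily small
  \<open>t\<close>; no approximating net is required.\<close>

lemma mem_dir_derivI: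
  assumes "\<And>s. 0 < s \<Longrightarrow>
    \<exists>t\<in>{0<..<s}. t *\<^sub>R w \<in> (f (xb + t *\<^sub>R x) \<oplus>\<^sub>c Hplus z') \<ominus>\<^sub>r f xb"
  shows "w \<in> dir_deriv f z' xb x"
  unfolding dir_deriv_def
proof (rule INT_I)
  fix s :: real assume "s \<in> {0<..}"
  then obtain t where t: "t \<in> {0<..<s}"
    and mem: "t *\<^sub>R w \<in> (f (xb + t *\<^sub>R x) \<oplus>\<^sub>c Hplus z') \<ominus>\<^sub>r f xb"
    using assms[of s] by auto
  have "w = (1 / t) *\<^sub>R (t *\<^sub>R w)" using t by simp
  with t mem show "w \<in> closure (\<Union>t\<in>{0<..<s}.
      (\<lambda>z. (1 / t) *\<^sub>R z) ` ((f (xb + t *\<^sub>R x) \<oplus>\<^sub>c Hplus z') \<ominus>\<^sub>r f xb))"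
    by (intro closure_subset[THEN subsetD] UN_I[of t] image_eqI[of w _ "t *\<^sub>R w"])
qed

lemma subdifferential_nonempty_imp_bdd:
  fixes f :: "'x::real_tvs \<Rightarrow> 'z::real_tvs set"
  assumes "linear z'" and "z' \<noteq> (\<lambda>z. 0)" and "x' \<in> subdifferential f z' xb"
  shows "f xb \<noteq> {}" and "bdd_below (z' ` f xb)"
proof -
  \<comment> \<open>\<open>S_fun x' z' 0\<close> is the half-space \<open>Hplus z'\<close>, so any
    point with negative \<open>z'\<close>-value separates it from the whole space.\<close>
  obtain w where w: "z' w = - 1" using linear_surj_real[OF assms(1,2)] by blast
  have "linear x'" using assms(3) by (simp add: subdifferential_def topological_dual_def)
  then have "w \<notin> S_fun x' z' 0" by (simp add: S_fun_def w linear_0)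
  then have nw: "w \<notin> dir_deriv f z' xb 0" using assms(3) by (auto simp: subdifferential_def)
  have *: "f xb \<noteq> {} \<and> bdd_below (z' ` f xb)"
  proof (rule ccontr)
    assume neg: "\<not> (f xb \<noteq> {} \<and> bdd_below (z' ` f xb))"
    \<comment> \<open>Both failures are covered: for empty \<open>f xb\<close> the claim is vacuous,
      otherwise the values of \<open>z'\<close> go below any bound. Either way the residual is the
      whole space.\<close>
    have "\<exists>a\<in>f xb. z' a \<le> z' (b + y)" if "b \<in> f xb" for b y
    proof (rule ccontr)
      assume "\<not> (\<exists>a\<in>f xb. z' a \<le> z' (b + y))"
      then have "bdd_below (z' ` f xb)" by (intro bdd_belowI[of _ "z' (b + y)"]) auto
      with neg that show False by blast
    qed
    then have "y \<in> (f xb \<oplus>\<^sub>c Hplus z') \<ominus>\<^sub>r f xb" for y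
      using closure_subset by (fastforce simp: mem_inf_residual closed_sum_def add_Hplus[OF assms(1)])
    then have "w \<in> dir_deriv f z' xb 0"
      by (intro mem_dir_derivI) (auto intro: dense)
    with nw show False ..
  qed
  then show "f xb \<noteq> {}" and "bdd_below (z' ` f xb)" by auto
qed

text \<open>A nearly \<open>z'\<close>-minimal point \<open>b\<close> of \<open>f xb\<close> is
  joined to \<open>z\<close> inside the graph. The strict inequality leaves the slack that pays for
  \<open>b\<close> missing the infimum.\<close>

lemma mem_dir_deriv_of_convex:
  fixes f :: "'x::real_tvs \<Rightarrow> 'z::real_tvs set"
  assumes "linear z'" and "convex_setfun f"
    and ne: "f xb \<noteq> {}" and bdd: "bdd_below (z' ` f xb)"
    and z: "z \<in> f (xb + x)" and w: "z' z - Inf (z' ` f xb) < z' w"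
  shows "w \<in> dir_deriv f z' xb x"
proof (rule mem_dir_derivI)
  fix s :: real assume "0 < s"
  define m where "m = Inf (z' ` f xb)"
  define d where "d = z' w - z' z + m"
  define t where "t = min (1 / 2) (s / 2)"
  have t: "0 < t" "t < s" "t < 1" using \<open>0 < s\<close> by (auto simp: t_def)
  \<comment> \<open>The point \<open>b\<close> is chosen after \<open>t\<close>: its error must be
    of order \<open>t\<close>, because the difference quotient divides by \<open>t\<close>.\<close>
  have "0 < t * d" using w t by (simp add: d_def m_def)
  then obtain b where b: "b \<in> f xb" "z' b < m + t * d"
    using cINF_less_iff[OF ne bdd, of "m + t * d"] by (auto simp: m_def)
  have "(1 - t) *\<^sub>R (xb, b) + t *\<^sub>R (xb + x, z) \<in> set_graph f"
    using assms(2) t b(1) z by (intro convexD) (auto simp: convex_setfun_def set_graph_def)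
  moreover have "(1 - t) *\<^sub>R xb + t *\<^sub>R (xb + x) = xb + t *\<^sub>R x"
    by (simp add: algebra_simps)
  ultimately have conv: "(1 - t) *\<^sub>R b + t *\<^sub>R z \<in> f (xb + t *\<^sub>R x)"
    by (simp add: set_graph_def)
  have "a + t *\<^sub>R w \<in> f (xb + t *\<^sub>R x) + Hplus z'" if "a \<in> f xb" for a
  proof -
    have "m \<le> z' a" using that bdd by (auto simp: m_def intro: cINF_lower)
    have "(1 - t) * (z' b - m) \<le> 1 * (t * d)"
      using b(2) t \<open>0 < t * d\<close> cINF_lower[OF bdd b(1)] by (intro mult_mono) (auto simp: m_def)
    then have "z' ((1 - t) *\<^sub>R b + t *\<^sub>R z) \<le> m + t * z' w"
      by (simp add: d_def linear_add[OF assms(1)] linear_diff[OF assms(1)] linear_scale[OF assms(1)] algebra_simps)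
    also have "\<dots> \<le> z' (a + t *\<^sub>R w)"
      using \<open>m \<le> z' a\<close> by (simp add: linear_add[OF assms(1)] linear_scale[OF assms(1)])
    finally show ?thesis using conv by (auto simp: add_Hplus[OF assms(1)])
  qed
  then show "\<exists>t\<in>{0<..<s}. t *\<^sub>R w \<in> (f (xb + t *\<^sub>R x) \<oplus>\<^sub>c Hplus z') \<ominus>\<^sub>r f xb"
    using t closure_subset by (intro bexI[of _ t]) (auto simp: mem_inf_residual closed_sum_def)
qed

text \<open>Each difference quotient already lies in \<open>S_fun x' z' x\<close>: the infimum over
  \<open>f xb\<close> cancels against the one in \<open>sub\<close>. Closures do no harm, as
  half-spaces of a continuous \<open>z'\<close> are closed.\<close>

lemma dir_deriv_subset_S_fun:
  fixes f :: "'x::real_tvs \<Rightarrow> 'z::real_tvs set"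
  assumes "z' \<in> topological_dual" and "linear x'"
    and ne: "f xb \<noteq> {}" and bdd: "bdd_below (z' ` f xb)"
    and sub: "\<And>t z. 0 < t \<Longrightarrow> z \<in> f (xb + t *\<^sub>R x) \<Longrightarrow> x' (t *\<^sub>R x) + Inf (z' ` f xb) \<le> z' z"
  shows "dir_deriv f z' xb x \<subseteq> S_fun x' z' x"
proof -
  define m where "m = Inf (z' ` f xb)"
  have lin: "linear z'" using assms(1) by (simp add: topological_dual_def)
  have "(1 / t) *\<^sub>R y \<in> S_fun x' z' x"
    if t: "0 < t" and y: "y \<in> (f (xb + t *\<^sub>R x) \<oplus>\<^sub>c Hplus z') \<ominus>\<^sub>r f xb" for t y
  proof -
    have "f (xb + t *\<^sub>R x) + Hplus z' \<subseteq> {z. x' (t *\<^sub>R x) + m \<le> z' z}"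
      using sub[OF t] by (force simp: m_def add_Hplus[OF lin])
    then have "f (xb + t *\<^sub>R x) \<oplus>\<^sub>c Hplus z' \<subseteq> {z. x' (t *\<^sub>R x) + m \<le> z' z}"
      unfolding closed_sum_def by (rule closure_minimal) (rule closed_halfspace_dual[OF assms(1)])
    then have "\<forall>a\<in>f xb. x' (t *\<^sub>R x) + m \<le> z' a + z' y"
      using y by (auto simp: mem_inf_residual linear_add[OF lin])
    then have "t * x' x \<le> z' y"
      unfolding cINF_le_iff_add_le[OF ne bdd] m_def by (simp add: linear_scale[OF assms(2)])
    then show ?thesis using t by (simp add: S_fun_def linear_scale[OF lin] field_simps)
  qed
  \<comment> \<open>An intersection is bounded by any one of its members; \<open>s = 1\<close> is
    taken.\<close>
  then have "closure (\<Union>t\<in>{0<..<1}.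
      (\<lambda>z. (1 / t) *\<^sub>R z) ` ((f (xb + t *\<^sub>R x) \<oplus>\<^sub>c Hplus z') \<ominus>\<^sub>r f xb)) \<subseteq> S_fun x' z' x"
    using closed_halfspace_dual[OF assms(1)] by (intro closure_minimal) (auto simp: S_fun_def)
  then show ?thesis unfolding dir_deriv_def by (meson INT_lower greaterThan_iff order_trans zero_less_one)
qed

text \<open>This is the usual subgradient inequality at \<open>xb\<close> for the scalarization
  sending \<open>x\<close> to the infimum of \<open>z'\<close> on \<open>f x\<close>. Stating it for
  each \<open>z\<close> in \<open>f x\<close> avoids infinite values of that infimum.\<close>

proposition mem_subdifferential_iff:
  fixes f :: "'x::real_tvs \<Rightarrow> 'z::real_tvs set"
  assumes "z' \<in> topological_dual" and "z' \<noteq> (\<lambda>z. 0)" and "convex_setfun f"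
    and ne: "f xb \<noteq> {}" and bdd: "bdd_below (z' ` f xb)"
  shows "x' \<in> subdifferential f z' xb \<longleftrightarrow>
    x' \<in> topological_dual \<and> (\<forall>x. \<forall>z\<in>f x. x' (x - xb) + Inf (z' ` f xb) \<le> z' z)"
    (is "_ \<longleftrightarrow> _ \<and> ?sub")
proof (intro iffI conjI)
  have lin: "linear z'" using assms(1) by (simp add: topological_dual_def)
  assume x': "x' \<in> subdifferential f z' xb"
  then show "x' \<in> topological_dual" by (simp add: subdifferential_def)
  show ?sub
  proof (intro allI ballI)
    fix x z assume "z \<in> f x"
    \<comment> \<open>Membership in the derivative is available only above the threshold, so the
      bound is shown for every larger \<open>r\<close> and then passed to the limit.\<close>
    have "x' (x - xb) \<le> r" if r: "z' z - Inf (z' ` f xb) < r" for r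
    proof -
      obtain w where w: "z' w = r" using linear_surj_real[OF lin assms(2)] by blast
      have "w \<in> dir_deriv f z' xb (x - xb)"
        using \<open>z \<in> f x\<close> r w by (intro mem_dir_deriv_of_convex[OF lin assms(3) ne bdd]) auto
      then have "w \<in> S_fun x' z' (x - xb)" using x' by (auto simp: subdifferential_def)
      then show ?thesis by (simp add: S_fun_def w)
    qed
    then have "x' (x - xb) \<le> z' z - Inf (z' ` f xb)" by (rule dense_ge)
    then show "x' (x - xb) + Inf (z' ` f xb) \<le> z' z" by simp
  qed
next
  assume asm: "x' \<in> topological_dual \<and> ?sub"
  then have lin: "linear x'" by (simp add: topological_dual_def)
  have "dir_deriv f z' xb x \<subseteq> S_fun x' z' x" for x
  proof (rule dir_deriv_subset_S_fun[where f = f and xb = xb, OF assms(1) lin ne bdd])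
    fix t z assume "z \<in> f (xb + t *\<^sub>R x)"
    with asm show "x' (t *\<^sub>R x) + Inf (z' ` f xb) \<le> z' z" by fastforce
  qed
  with asm show "x' \<in> subdifferential f z' xb" by (simp add: subdifferential_def)
qed

lemma S_fun_residual_subset_iff:
  fixes z' :: "'z::real_vector \<Rightarrow> real"
  assumes "linear z'" and "z' \<noteq> (\<lambda>z. 0)" and ne: "A \<noteq> {}" and bdd: "bdd_below (z' ` A)"
  shows "S_fun x' z' xb \<ominus>\<^sub>r A \<subseteq> S_fun x' z' x \<longleftrightarrow> x' x \<le> x' xb - Inf (z' ` A)"
proof -
  have eq: "S_fun x' z' xb \<ominus>\<^sub>r A = {y. x' xb - Inf (z' ` A) \<le> z' y}"
    using cINF_le_iff_add_le[OF ne bdd]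
    by (auto simp: mem_inf_residual S_fun_def linear_add[OF assms(1)] diff_le_eq add.commute)
  \<comment> \<open>The residual and \<open>S_fun x' z' x\<close> are parallel half-spaces, so a
    boundary point of the first decides the inclusion.\<close>
  obtain w where "z' w = x' xb - Inf (z' ` A)" using linear_surj_real[OF assms(1,2)] by blast
  then show ?thesis unfolding eq by (auto simp: S_fun_def dest: subsetD[of _ _ w])
qed

lemma translative_mem:
  fixes f :: "'x::real_vector \<Rightarrow> 'z::real_vector set"
  assumes "translative T f"
  shows "b + z \<in> f (x + T z) \<longleftrightarrow> b \<in> f x"
  using assms by (auto simp: translative_def set_plus_def)

theorem corollary5p22:
  fixes T :: "'z::real_lctvs \<Rightarrow> 'x::real_lctvs"
    and C :: "'z set"
    and f :: "'x \<Rightarrow> 'z set"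
    and z' :: "'z \<Rightarrow> real"
    and xb :: 'x
  assumes "(UNIV :: 'x set) \<noteq> {0}" and "(UNIV :: 'z set) \<noteq> {0}"
    and "convex C" and "cone C" and "0 \<in> C"
    and "linear T" and "continuous_on UNIV T" and "inj T"
    and "\<forall>x. f x \<in> upper_sets C"
    and "convex_setfun f"
    and "translative T f"
    and "z' \<in> dual_cone C - {\<lambda>z. 0}"
    and "subdifferential f z' xb \<noteq> {}"
  shows "subdifferential f z' xb =
    {x' \<in> topological_dual. z' = dual_adjoint T x' \<and>
       (\<forall>x\<in>zero_level_set f.
          S_fun x' (dual_adjoint T x') x \<supseteq> S_fun x' (dual_adjoint T x') xb \<ominus>\<^sub>r f xb)}"
proof -
  define m where "m = Inf (z' ` f xb)"
  have dual: "z' \<in> topological_dual" and nz: "z' \<noteq> (\<lambda>z. 0)"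
    using assms(12) by (auto simp: dual_cone_def)
  then have lin: "linear z'" by (simp add: topological_dual_def)
  obtain x0 where "x0 \<in> subdifferential f z' xb" using assms(13) by blast
  note ne = subdifferential_nonempty_imp_bdd(1)[OF lin nz this]
    and bdd = subdifferential_nonempty_imp_bdd(2)[OF lin nz this]
  have "(\<forall>x. \<forall>z\<in>f x. x' (x - xb) + m \<le> z' z) \<longleftrightarrow>
      z' = dual_adjoint T x' \<and> (\<forall>x\<in>zero_level_set f. x' x \<le> x' xb - m)"
    if "x' \<in> topological_dual" for x'
  proof (intro iffI conjI)
    have lin': "linear x'" using that by (simp add: topological_dual_def)
    {
      assume sub: "\<forall>x. \<forall>z\<in>f x. x' (x - xb) + m \<le> z' z"
      have "dual_adjoint T x' z \<le> z' z" for z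
      proof -
        have "\<forall>b\<in>f xb. x' (T z) + m \<le> z' b + z' z"
        proof
          fix b assume "b \<in> f xb"
          then have "b + z \<in> f (xb + T z)" by (simp add: translative_mem[OF assms(11)])
          with sub have "x' (xb + T z - xb) + m \<le> z' (b + z)" by blast
          then show "x' (T z) + m \<le> z' b + z' z" by (simp add: linear_add[OF lin])
        qed
        then show ?thesis
          unfolding cINF_le_iff_add_le[OF ne bdd] by (simp add: m_def dual_adjoint_def)
      qed
      \<comment> \<open>A linear functional dominated by another one equals it, as seen by comparing
        at \<open>z\<close> and \<open>- z\<close>.\<close>
      then show "z' = dual_adjoint T x'"
        using linear_le_imp_eq[OF _ lin] linear_compose[OF assms(6) lin']
        by (metis dual_adjoint_def)
      show "\<forall>x\<in>zero_level_set f. x' x \<le> x' xb - m"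
        using sub by (fastforce simp: zero_level_set_def linear_diff[OF lin'] linear_0[OF lin])
    }
    assume asm: "z' = dual_adjoint T x' \<and> (\<forall>x\<in>zero_level_set f. x' x \<le> x' xb - m)"
    show "\<forall>x. \<forall>z\<in>f x. x' (x - xb) + m \<le> z' z"
    proof (intro allI ballI)
      fix x z assume "z \<in> f x"
      then have "0 \<in> f (x - T z)"
        using translative_mem[OF assms(11), of 0 z "x - T z"] by simp
      with asm have "x' (x - T z) \<le> x' xb - m" by (simp add: zero_level_set_def)
      moreover have "x' (T z) = z' z" using asm by (simp add: dual_adjoint_def)
      ultimately show "x' (x - xb) + m \<le> z' z" by (simp add: linear_diff[OF lin'])
    qed
  qed
  then have "x' \<in> subdifferential f z' xb \<longleftrightarrow>
      x' \<in> topological_dual \<and> z' = dual_adjoint T x' \<and>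
      (\<forall>x\<in>zero_level_set f. S_fun x' z' xb \<ominus>\<^sub>r f xb \<subseteq> S_fun x' z' x)" for x'
    unfolding mem_subdifferential_iff[OF dual nz assms(10) ne bdd]
      S_fun_residual_subset_iff[OF lin nz ne bdd] m_def by blast
  \<comment> \<open>Under the equation \<open>z' = dual_adjoint T x'\<close> the two functionals are
    interchangeable inside \<open>S_fun\<close>.\<close>
  then show ?thesis by (intro set_eqI) (unfold mem_Collect_eq, metis)
qed

end
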